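(* In the open online TSP on the line under the LOCATIONS prediction model, the algorithm NEARFIRST is $\min\{f(\eta),3\}$-competitive, where $\eta$ is the prediction error and $f(\eta)=1+\frac{2(1+\eta)}{3-2\eta}$ for $\eta<\frac{2}{3}$ and $f(\eta)=3$ for $\eta\ge\frac{2}{3}$.
   Context: Online TSP on the line: an agent starts at the origin at time $0$ and moves on the real line with speed at most $1$. There is a set $Q=\{q_1,\dots,q_n\}$ of requests, each with a position (also denoted $q_i$) and a release time $rel(q_i)$; the algorithm knows $n$ in advance and learns a request only at its release time. A request $q$ is served at time $t$ if the agent was at position $q$ at some time $t'$ with $rel(q)\le t'\le t$. In the open variant the makespan $|ALG|$ is the first time at which all requests are served (no return to origin required). $|OPT|$ is the optimal offline makespan; $c$-competitive means $|ALG|\le c|OPT|$ on every instance. LOCATIONS prediction model: at time $0$ the algorithm receives predictions $P=\{p_1,\dots,p_n\}$, $p_i$ a predicted position for $q_i$. By convention $Q$ contains a request at the origin released at time $0$ with prediction exactly $0$. Let $L=\min Q$, $R=\max Q$; the error is $\eta=\max_i|q_i-p_i|/(|L|+|R|)$. NEARFIRST: whenever a request is released (and at time $0$) it recomputes a plan and executes it at unit speed, waiting when the plan is exhausted. With $pos$ the current position, $O$ the set of released unserved requests, and $P'$ the set of predictions whose requests are not yet released: if $P'$ is empty, then if $pos<\frac{\max O+\min O}{2}$ move to $\min O$ then to $\max O$, else move to $\max O$ then to $\min O$. Otherwise, if $|\min P|<|\max P|$, move to $\min(P'\cup O)$ then to $\min P'$; else move to $\max(P'\cup O)$ then to $\max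 P'$. *)

theory Defs
  imports "HOL-Analysis.Analysis"
begin

text \<open>Requests are indexed by \<open>i < num I\<close>; distinct requests may share a position.\<close>

record tsp_instance =
  num :: nat
  loc :: "nat \<Rightarrow> real"
  rel :: "nat \<Rightarrow> real"
  prd :: "nat \<Rightarrow> real"

definition valid_instance :: "tsp_instance \<Rightarrow> bool" where
  "valid_instance I \<longleftrightarrow>
     (\<forall>i < num I. 0 \<le> rel I i) \<and>
     (\<exists>i < num I. loc I i = 0 \<and> rel I i = 0 \<and> prd I i = 0)"

definition leftmost :: "tsp_instance \<Rightarrow> real" where
  "leftmost I = Min (loc I ` {..<num I})"

definition rightmost :: "tsp_instance \<Rightarrow> real" where
  "rightmost I = Max (loc I ` {..<num I})"

text \<open>The quotient is taken in \<^typ>\<open>ereal\<close> because the denominator vanishes when all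
  requests are at the origin: the error is then \<open>0\<close> if all predictions are exact
  (\<open>0 / 0 = 0\<close>) and \<open>\<infinity>\<close> otherwise.\<close>

definition pred_error :: "tsp_instance \<Rightarrow> ereal" where
  "pred_error I =
     ereal (Max ((\<lambda>i. \<bar>loc I i - prd I i\<bar>) ` {..<num I})) /
     ereal (\<bar>leftmost I\<bar> + \<bar>rightmost I\<bar>)"

text \<open>Only the values at times \<open>t \<ge> 0\<close> are relevant.\<close>

definition trajectories :: "(real \<Rightarrow> real) set" where
  "trajectories = {s. s 0 = 0 \<and> 1-lipschitz_on {0..} s}"

definition served :: "tsp_instance \<Rightarrow> (real \<Rightarrow> real) \<Rightarrow> nat \<Rightarrow> real \<Rightarrow> bool" where
  "served I s i t \<longleftrightarrow> (\<exists>t'. rel I i \<le> t' \<and> t' \<le> t \<and> s t' = loc I i)"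

text \<open>The value is \<open>\<infinity>\<close> if some request is never served.\<close>

definition makespan :: "tsp_instance \<Rightarrow> (real \<Rightarrow> real) \<Rightarrow> ereal" where
  "makespan I s = (INF t\<in>{t. 0 \<le> t \<and> (\<forall>i < num I. served I s i t)}. ereal t)"

definition opt_makespan :: "tsp_instance \<Rightarrow> ereal" where
  "opt_makespan I = (INF s\<in>trajectories. makespan I s)"

text \<open>An algorithm is given by the trajectory it produces on each instance; the ratio is a
  function of the prediction error.\<close>

definition competitive :: "(tsp_instance \<Rightarrow> real \<Rightarrow> real) \<Rightarrow> (ereal \<Rightarrow> ereal) \<Rightarrow> bool" where
  "competitive alg c \<longleftrightarrow>
     (\<forall>I. valid_instance I \<longrightarrow> makespan I (alg I) \<le> c (pred_error I) * opt_makespan I)"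

text \<open>\<open>walk x ws d\<close> is the position after time \<open>d\<close> when moving at unit speed from \<open>x\<close> through
  the waypoints \<open>ws\<close> in order and waiting at the last one.\<close>

fun walk :: "real \<Rightarrow> real list \<Rightarrow> real \<Rightarrow> real" where
  "walk x [] d = x"
| "walk x (w # ws) d =
     (if d < \<bar>w - x\<bar> then x + sgn (w - x) * d else walk w ws (d - \<bar>w - x\<bar>))"

text \<open>The plan computed at time \<open>\<tau>\<close>, where \<open>s\<close> is the trajectory followed up to time \<open>\<tau>\<close>;
  \<open>Rq\<close> are the positions of the released unserved requests.
  If nothing is left to be served or predicted, the plan is empty.\<close>

definition nearfirst_plan :: "tsp_instance \<Rightarrow> (real \<Rightarrow> real) \<Rightarrow> real \<Rightarrow> real list" where
  "nearfirst_plan I s \<tau> =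
     (let Rq = loc I ` {i. i < num I \<and> rel I i \<le> \<tau> \<and> \<not> served I s i \<tau>};
          P = prd I ` {..<num I};
          P' = prd I ` {i. i < num I \<and> \<tau> < rel I i}
      in if P' = {} then
           (if Rq = {} then []
            else if s \<tau> < (Max Rq + Min Rq) / 2 then [Min Rq, Max Rq]
            else [Max Rq, Min Rq])
         else if \<bar>Min P\<bar> < \<bar>Max P\<bar> then [Min (P' \<union> Rq), Min P']
         else [Max (P' \<union> Rq), Max P'])"

definition replan :: "tsp_instance \<Rightarrow> real \<Rightarrow> (real \<Rightarrow> real) \<Rightarrow> real \<Rightarrow> real" where
  "replan I \<tau> s = (\<lambda>t. if t \<le> \<tau> then s t else walk (s \<tau>) (nearfirst_plan I s \<tau>) (t - \<tau>))"

definition event_times :: "tsp_instance \<Rightarrow> real list" where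
  "event_times I = sorted_list_of_set (insert 0 (rel I ` {..<num I}))"

definition nearfirst :: "tsp_instance \<Rightarrow> real \<Rightarrow> real" where
  "nearfirst I = fold (replan I) (event_times I) (\<lambda>_. 0)"

definition nearfirst_ratio :: "ereal \<Rightarrow> ereal" where
  "nearfirst_ratio \<eta> = (if \<eta> < 2 / 3 then 1 + 2 * (1 + \<eta>) / (3 - 2 * \<eta>) else 3)"

lemma walk_0: "walk x ws 0 = x"
  by (induction ws arbitrary: x) auto

lemma walk_dist: "0 \<le> d \<Longrightarrow> d \<le> e \<Longrightarrow> \<bar>walk x ws e - walk x ws d\<bar> \<le> e - d"
proof (induction ws arbitrary: x d e)
  case Nil
  then show ?case by simp
next
  case (Cons w ws)
  let ?l = "\<bar>w - x\<bar>"
  consider "e < ?l" | "?l \<le> d" | "d < ?l" "?l \<le> e" by linarith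
  then show ?case
  proof cases
    case 1
    then show ?thesis using Cons.prems by (auto simp: sgn_real_def)
  next
    case 2
    then show ?thesis using Cons.prems Cons.IH[of "d - ?l" "e - ?l" w] by auto
  next
    case 3
    have "\<bar>walk w ws (e - ?l) - w\<bar> \<le> e - ?l"
      using Cons.IH[of 0 "e - ?l" w] 3 by (simp add: walk_0)
    moreover have "\<bar>w - (x + sgn (w - x) * d)\<bar> \<le> ?l - d"
      using 3 by (auto simp: sgn_real_def)
    ultimately show ?thesis using 3 by auto
  qed
qed

lemma trajectoriesI:
  assumes "s 0 = 0" "\<And>t u. 0 \<le> t \<Longrightarrow> t \<le> u \<Longrightarrow> \<bar>s u - s t\<bar> \<le> u - t"
  shows "s \<in> trajectories"
proof -
  have "dist (s t) (s u) \<le> 1 * dist t u" if "0 \<le> t" "0 \<le> u" for t u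
    using assms(2)[of t u] assms(2)[of u t] that by (cases "t \<le> u") (auto simp: dist_real_def)
  then show ?thesis
    using assms(1) by (auto simp: trajectories_def lipschitz_on_def)
qed

lemma trajectoriesD:
  assumes "s \<in> trajectories" "0 \<le> t" "t \<le> u"
  shows "\<bar>s u - s t\<bar> \<le> u - t"
  using assms lipschitz_onD[of 1 "{0..}" s u t]
  by (auto simp: trajectories_def dist_real_def)

lemma replan_trajectory:
  assumes s: "s \<in> trajectories" and \<tau>: "0 \<le> \<tau>"
  shows "replan I \<tau> s \<in> trajectories"
proof (rule trajectoriesI)
  show "replan I \<tau> s 0 = 0"
    using s \<tau> by (simp add: replan_def trajectories_def)
next
  fix t u :: real
  assume tu: "0 \<le> t" "t \<le> u"
  let ?w = "walk (s \<tau>) (nearfirst_plan I s \<tau>)"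
  consider "u \<le> \<tau>" | "\<tau> < t" | "t \<le> \<tau>" "\<tau> < u" by linarith
  then show "\<bar>replan I \<tau> s u - replan I \<tau> s t\<bar> \<le> u - t"
  proof cases
    case 1
    then show ?thesis using trajectoriesD[OF s tu] tu by (simp add: replan_def)
  next
    case 2
    then show ?thesis
      using walk_dist[of "t - \<tau>" "u - \<tau>" "s \<tau>"] tu by (simp add: replan_def)
  next
    case 3
    have "\<bar>?w (u - \<tau>) - s \<tau>\<bar> \<le> u - \<tau>"
      using walk_dist[of 0 "u - \<tau>" "s \<tau>"] 3 by (simp add: walk_0)
    then show ?thesis
      using trajectoriesD[OF s tu(1) 3(1)] 3 by (simp add: replan_def)
  qed
qed

lemma nearfirst_trajectory:
  assumes "valid_instance I"
  shows "nearfirst I \<in> trajectories"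
proof -
  have "fold (replan I) \<tau>s s \<in> trajectories"
    if "\<forall>\<tau>\<in>set \<tau>s. 0 \<le> \<tau>" "s \<in> trajectories" for \<tau>s s
    using that by (induction \<tau>s arbitrary: s) (auto intro: replan_trajectory)
  moreover have "\<forall>\<tau>\<in>set (event_times I). 0 \<le> \<tau>"
    using assms by (auto simp: event_times_def valid_instance_def
        simp del: sorted_list_of_set_insert_remove)
  moreover have "(\<lambda>_. 0) \<in> trajectories"
    by (rule trajectoriesI) auto
  ultimately show ?thesis by (simp add: nearfirst_def)
qed

end

theory Submission
  imports Defs
begin

text \<open>Since \<open>f \<eta> = 5 / (3 - 2 * \<eta>)\<close>, it suffices to bound the completion time \<open>T\<close> after the last
  release. Up to reflection the agent favours the left end, so that \<open>- L \<le> R + 2 * e\<close>, where \<open>e\<close>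
  is the absolute prediction error. Until it first turns around it moves left at full speed.
  Afterwards it stays to the left of every outstanding prediction, hence leaves unserved only requests
  at most \<open>e\<close> to its left, and the time at which a sweep to \<open>R\<close> would end grows only when it waits
  at a prediction or a request is released behind it. With \<open>i\<close> the request it waits for or goes back
  to, both cases give \<open>T \<le> rel i + R - loc i + e\<close>; otherwise \<open>T \<le> R - 2 * L + 2 * e\<close>.
  The optimum either visits \<open>R\<close> after \<open>i\<close>, and then takes at least \<open>rel i + R - loc i\<close>, or before \<open>i\<close>, and then takes at least \<open>2 * R - loc i\<close>.
  The latter is only weak when the two ends are at comparable distances, and then the bound
  \<open>R - L + min (- L) R\<close> on the optimum suffices.\<close>

section \<open>Arithmetic of the competitive ratio\<close>

text \<open>Pure arithmetic: \<open>Z\<close> stands for an offline completion time,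
  \<open>t\<close> for the last release and \<open>T\<close> for the online completion time. The
  threshold \<open>M * (1 / 2 - \<eta>)\<close> for \<open>- L\<close> separates the instances whose
  two ends are both far enough out to force \<open>M * (3 / 2 - \<eta>) \<le> Z\<close> from those
  with a dominant right end.\<close>

lemma ratio_bound:
  fixes L R e \<eta> t T Z :: real
  assumes \<eta>: "0 \<le> \<eta>" "\<eta> < 2 / 3" and LR: "L \<le> 0" "0 \<le> R" and e: "e \<le> \<eta> * (R - L)"
    and near: "- L \<le> R + 2 * e"
    and opt: "t \<le> Z" "R - L + min (- L) R \<le> Z"
    and T: "T \<le> R - 2 * L \<or> T \<le> t + (R - L) + e \<and>
      (T \<le> R - 2 * L + 2 * e \<or>
        (\<exists>r x. T \<le> r + R - x + e \<and> r \<le> Z \<and> L \<le> x \<and> x \<le> R \<and> (r + R - x \<le> Z \<or> 2 * R - x \<le> Z)))"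
  shows "(3 - 2 * \<eta>) * T \<le> 5 * Z"
proof -
  define M where "M = R - L"
  have M: "0 \<le> M" "M \<le> Z" "0 \<le> Z" and eM: "e \<le> \<eta> * M"
    using LR opt e by (auto simp: M_def)
  have ge0: "0 \<le> 3 - 2 * \<eta>" using \<eta> by simp
  have mono: "(3 - 2 * \<eta>) * a \<le> (3 - 2 * \<eta>) * b" if "a \<le> b" for a b
    using ge0 that by (rule mult_left_mono[rotated])
  \<comment> \<open>Since \<open>5 = (3 - 2 * \<eta>) + (2 + 2 * \<eta>)\<close>, only the excess of
    \<open>T\<close> over \<open>Z\<close> has to be estimated.\<close>
  have excess: "(3 - 2 * \<eta>) * T \<le> 5 * Z"
    if "T \<le> Z + X" "(3 - 2 * \<eta>) * X \<le> (2 + 2 * \<eta>) * Z" for X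
    using mono[OF that(1)] that(2) by (simp add: algebra_simps)
  have additive: "(3 - 2 * \<eta>) * T \<le> 5 * Z" if "T \<le> Z + 2 * \<eta> * M"
  proof (rule excess)
    show "T \<le> Z + 2 * \<eta> * Z"
      using that mult_left_mono[OF M(2), of "2 * \<eta>"] \<eta> by simp
    have "0 \<le> (2 * (1 - 2 * \<eta> + 2 * \<eta>\<^sup>2)) * Z"
    proof (rule mult_nonneg_nonneg)
      have "0 \<le> (1 - \<eta>)\<^sup>2 + \<eta>\<^sup>2" by simp
      then show "0 \<le> 2 * (1 - 2 * \<eta> + 2 * \<eta>\<^sup>2)" by (simp add: power2_eq_square algebra_simps)
    qed (use M in simp)
    then show "(3 - 2 * \<eta>) * (2 * \<eta> * Z) \<le> (2 + 2 * \<eta>) * Z"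
      by (simp add: power2_eq_square algebra_simps)
  qed
  have \<eta>M: "0 \<le> \<eta> * M" using \<eta> M by simp
  show ?thesis
  proof (cases "M * (1 / 2 - \<eta>) \<le> - L")
    case True
    have "M / 2 - \<eta> * M \<le> R"
      using near eM M_def by argo
    moreover have "M / 2 - \<eta> * M \<le> - L" using True by (simp add: algebra_simps)
    ultimately have "M + (M / 2 - \<eta> * M) \<le> Z" using opt(2) M_def by linarith
    then have Z: "M * (3 / 2 - \<eta>) \<le> Z" by (simp add: algebra_simps)
    show ?thesis
    proof (cases "T \<le> t + M + e")
      case True
      show ?thesis
      proof (rule excess)
        show "T \<le> Z + (1 + \<eta>) * M" using True opt eM by (simp add: algebra_simps)
        \<comment> \<open>This determines the shape of the ratio:
          \<open>(3 - 2 * \<eta>) * (1 + \<eta>)\<close> equals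
          \<open>(2 + 2 * \<eta>) * (3 / 2 - \<eta>)\<close>.\<close>
        have "(2 + 2 * \<eta>) * (M * (3 / 2 - \<eta>)) \<le> (2 + 2 * \<eta>) * Z"
          using Z \<eta> by (intro mult_left_mono) auto
        then show "(3 - 2 * \<eta>) * ((1 + \<eta>) * M) \<le> (2 + 2 * \<eta>) * Z"
          by (simp add: algebra_simps)
      qed
    next
      case False
      then have T': "T \<le> M - L" using T by (auto simp: M_def)
      show ?thesis
      proof (cases "- L \<le> R")
        case True
        then show ?thesis using T' opt additive \<eta>M by (simp add: M_def)
      next
        case False
        have "- L \<le> M / 2 + \<eta> * M"
          using near eM M_def by argo
        then have "T \<le> M * (3 / 2 + \<eta>)"
          using T' by (simp add: algebra_simps)
        from mono[OF this] have "(3 - 2 * \<eta>) * T \<le> (3 / 2 + \<eta>) * ((3 - 2 * \<eta>) * M)"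
          by (simp only: mult_ac)
        also have "\<dots> \<le> 5 / 2 * ((3 - 2 * \<eta>) * M)"
          using \<eta> ge0 M by (intro mult_right_mono) auto
        also have "\<dots> \<le> 5 * Z" using Z by (simp add: algebra_simps)
        finally show ?thesis .
      qed
    qed
  next
    case False
    have LR': "- L \<le> R" "M * (1 / 2 + \<eta>) \<le> R"
    proof -
      have "- L < M / 2 - \<eta> * M" using False by (simp add: algebra_simps)
      then show "- L \<le> R" using \<eta>M M_def LR by linarith
      have "M / 2 + \<eta> * M \<le> R" using \<open>- L < M / 2 - \<eta> * M\<close> M_def by linarith
      then show "M * (1 / 2 + \<eta>) \<le> R" by (simp add: algebra_simps)
    qed
    have opt': "M - L \<le> Z" using LR' opt by (simp add: M_def)
    from T consider "T \<le> R - 2 * L + 2 * e" | "T \<le> R - 2 * L" | r x where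
        "T \<le> r + R - x + e" "r \<le> Z" "L \<le> x" "x \<le> R" "r + R - x \<le> Z \<or> 2 * R - x \<le> Z"
      by auto
    then show ?thesis
    proof cases
      case 1
      then show ?thesis using additive eM opt' by (simp add: M_def)
    next
      case 2
      then show ?thesis using additive \<eta>M opt' by (simp add: M_def)
    next
      case 3
      show ?thesis
      proof (cases "r + R - x \<le> Z")
        case True
        then show ?thesis using additive 3 eM \<eta>M by simp
      next
        case False
        \<comment> \<open>What remains is \<open>2 * R - x \<le> Z\<close>, that is
          \<open>R + X \<le> Z\<close>, in which the dominant right end contributes
          \<open>M * (1 / 2 + \<eta>) \<le> R\<close>.\<close>
        define X where "X = R - x"
        have X: "0 \<le> X" "X \<le> M" and Z: "X + M * (1 / 2 + \<eta>) \<le> Z"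
          using 3 False LR' by (auto simp: X_def M_def)
        show ?thesis
        proof (rule excess)
          show "T \<le> Z + (X + \<eta> * M)" using 3 eM by (simp add: X_def)
          \<comment> \<open>The right-hand side is the difference of the two sides of the next
            inequality, grouped so that \<open>X \<le> M\<close> shows its sign.\<close>
          have "0 \<le> X * (4 * \<eta>) + (M - X) + 4 * \<eta>\<^sup>2 * M"
            using X \<eta> M by (intro add_nonneg_nonneg) auto
          then have "(3 - 2 * \<eta>) * (X + \<eta> * M) \<le> (2 + 2 * \<eta>) * (X + M * (1 / 2 + \<eta>))"
            by (simp add: algebra_simps power2_eq_square)
          also have "\<dots> \<le> (2 + 2 * \<eta>) * Z"
            using Z \<eta> by (intro mult_left_mono) auto
          finally show "(3 - 2 * \<eta>) * (X + \<eta> * M) \<le> (2 + 2 * \<eta>) * Z" .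
        qed
      qed
    qed
  qed
qed

section \<open>Lower bounds on the offline optimum\<close>

lemma valid_nonempty: "valid_instance I \<Longrightarrow> {..<num I} \<noteq> {}"
  by (auto simp: valid_instance_def)

lemma leftmost_le: "i < num I \<Longrightarrow> leftmost I \<le> loc I i"
  by (simp add: leftmost_def)

lemma rightmost_ge: "i < num I \<Longrightarrow> loc I i \<le> rightmost I"
  by (simp add: rightmost_def)

lemma leftmost_attained:
  assumes "valid_instance I"
  obtains i where "i < num I" "loc I i = leftmost I"
  using Min_in[of "loc I ` {..<num I}"] valid_nonempty[OF assms]
  by (fastforce simp: leftmost_def)

lemma rightmost_attained:
  assumes "valid_instance I"
  obtains i where "i < num I" "loc I i = rightmost I"
  using Max_in[of "loc I ` {..<num I}"] valid_nonempty[OF assms]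
  by (fastforce simp: rightmost_def)

lemma leftmost_le_0: "valid_instance I \<Longrightarrow> leftmost I \<le> 0"
  using leftmost_le by (fastforce simp: valid_instance_def)

lemma rightmost_ge_0: "valid_instance I \<Longrightarrow> 0 \<le> rightmost I"
  using rightmost_ge by (fastforce simp: valid_instance_def)

lemma trajectory_bound:
  assumes "s \<in> trajectories" "0 \<le> t"
  shows "\<bar>s t\<bar> \<le> t"
  using trajectoriesD[of s 0 t] assms by (simp add: trajectories_def)

lemma trajectory_dist:
  assumes "s \<in> trajectories" "0 \<le> t" "0 \<le> u"
  shows "\<bar>s u - s t\<bar> \<le> \<bar>u - t\<bar>"
  using trajectoriesD[of s t u] trajectoriesD[of s u t] assms by (cases "t \<le> u") auto

lemma opt_release:
  assumes "\<forall>i<num I. served I s i Z" "i < num I"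
  shows "rel I i \<le> Z"
  using assms by (force simp: served_def)

text \<open>The end visited second costs the distance of the other end from the origin plus the full
  width.\<close>

lemma opt_extremes:
  assumes I: "valid_instance I" and s: "s \<in> trajectories" and Z: "\<forall>i<num I. served I s i Z"
  shows "rightmost I - leftmost I + min (- leftmost I) (rightmost I) \<le> Z"
proof -
  obtain i j where i: "i < num I" "loc I i = leftmost I" and j: "j < num I" "loc I j = rightmost I"
    using leftmost_attained[OF I] rightmost_attained[OF I] by metis
  obtain u v where "rel I i \<le> u" "u \<le> Z" "s u = leftmost I" "rel I j \<le> v" "v \<le> Z" "s v = rightmost I"
    using Z i j by (metis served_def)
  moreover have "0 \<le> rel I i" "0 \<le> rel I j" using I i j by (auto simp: valid_instance_def)
  ultimately show ?thesis
    using trajectory_bound[OF s, of u] trajectory_bound[OF s, of v] trajectory_dist[OF s, of u v]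
    by linarith
qed

text \<open>The order of the two visits decides: if \<open>R\<close> comes after request
  \<open>i\<close>, the distance between them is walked after the release; otherwise reaching
  \<open>R\<close> takes time at least \<open>R\<close>, and the way back to \<open>i\<close> is
  added.\<close>

lemma opt_release_extreme:
  assumes I: "valid_instance I" and s: "s \<in> trajectories" and Z: "\<forall>i<num I. served I s i Z"
    and i: "i < num I"
  shows "rel I i + rightmost I - loc I i \<le> Z \<or> 2 * rightmost I - loc I i \<le> Z"
proof -
  obtain j where j: "j < num I" "loc I j = rightmost I"
    using rightmost_attained[OF I] by metis
  obtain u v where "rel I i \<le> u" "u \<le> Z" "s u = loc I i" "rel I j \<le> v" "v \<le> Z" "s v = rightmost I"
    using Z i j by (metis served_def)
  moreover have "0 \<le> rel I i" "0 \<le> rel I j" using I i j by (auto simp: valid_instance_def)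
  ultimately show ?thesis
    using trajectory_bound[OF s, of v] trajectory_dist[OF s, of u v] by linarith
qed

section \<open>Runs that favour the left end\<close>

definition pending :: "tsp_instance \<Rightarrow> (real \<Rightarrow> real) \<Rightarrow> real \<Rightarrow> nat set" where
  "pending I s \<tau> = {i. i < num I \<and> rel I i \<le> \<tau> \<and> \<not> served I s i \<tau>}"

definition unreleased :: "tsp_instance \<Rightarrow> real \<Rightarrow> nat set" where
  "unreleased I \<tau> = {i. i < num I \<and> \<tau> < rel I i}"

definition events :: "tsp_instance \<Rightarrow> real set" where
  "events I = insert 0 (rel I ` {..<num I})"

definition max_error :: "tsp_instance \<Rightarrow> real" where
  "max_error I = Max ((\<lambda>i. \<bar>loc I i - prd I i\<bar>) ` {..<num I})"

lemma finite_pending: "finite (pending I s \<tau>)"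
  and finite_unreleased: "finite (unreleased I \<tau>)"
  and finite_events: "finite (events I)"
  by (simp_all add: pending_def unreleased_def events_def)

lemma events_ge_0: "valid_instance I \<Longrightarrow> \<tau> \<in> events I \<Longrightarrow> 0 \<le> \<tau>"
  by (auto simp: events_def valid_instance_def)

lemma max_error_ge: "i < num I \<Longrightarrow> \<bar>loc I i - prd I i\<bar> \<le> max_error I"
  by (simp add: max_error_def)

lemma max_error_ge_0: "valid_instance I \<Longrightarrow> 0 \<le> max_error I"
  using max_error_ge by (fastforce simp: valid_instance_def)

lemma served_mono: "served I s i t \<Longrightarrow> t \<le> u \<Longrightarrow> served I s i u"
  by (force simp: served_def)

lemma walk2_up:
  assumes "w1 \<le> w2" "\<bar>w1 - x\<bar> \<le> d"
  shows "walk x [w1, w2] d = min (w1 + (d - \<bar>w1 - x\<bar>)) w2"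
  using assms by (auto simp: sgn_real_def min_def)

text \<open>Covers both the left-favouring algorithm and the reflection of the right-favouring one;
  \<open>near\<close> is not strict because ties go to the right and are reflected.
  \<open>step\<close> describes motion only while some request is unreleased; the final plan is
  treated separately.\<close>

locale leftward_run =
  fixes I :: tsp_instance and s :: "real \<Rightarrow> real"
  assumes valid: "valid_instance I"
    and near: "- Min (prd I ` {..<num I}) \<le> Max (prd I ` {..<num I})"
    and start: "s 0 = 0"
    and step: "\<lbrakk>\<tau> \<in> events I; unreleased I \<tau> \<noteq> {}; \<tau> \<le> t; \<forall>i<num I. rel I i \<le> \<tau> \<or> t \<le> rel I i\<rbrakk> \<Longrightarrow>
      s t = walk (s \<tau>) [Min (prd I ` unreleased I \<tau> \<union> loc I ` pending I s \<tau>),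
        Min (prd I ` unreleased I \<tau>)] (t - \<tau>)"
begin

abbreviation "L \<equiv> leftmost I"
abbreviation "R \<equiv> rightmost I"
abbreviation "e \<equiv> max_error I"

text \<open>The first alternative is the length of a walk from the origin to \<open>L - e\<close>
  and then to \<open>R\<close>. The second is the end of a sweep to \<open>R\<close> started from
  \<open>loc I i - e\<close> when \<open>i\<close> is released.\<close>

definition within_budget :: "real \<Rightarrow> bool" where
  "within_budget T \<longleftrightarrow> T \<le> R - 2 * L + 2 * e \<or> (\<exists>i<num I. T \<le> rel I i + R - loc I i + e)"

lemma within_budget_mono: "within_budget T \<Longrightarrow> T' \<le> T \<Longrightarrow> within_budget T'"
  by (force simp: within_budget_def)

lemma within_budget_release:
  "i < num I \<Longrightarrow> T \<le> rel I i + R - loc I i + e \<Longrightarrow> within_budget T"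
  by (auto simp: within_budget_def)

text \<open>From this state on the agent only has to sweep to the right, up to excursions of length at
  most \<open>e\<close>. The last two conjuncts bound the time at which a sweep to \<open>R\<close> would end,
  starting at once or after fetching a pending request.\<close>

definition sweeping :: "real \<Rightarrow> bool" where
  "sweeping \<tau> \<longleftrightarrow> (\<forall>i\<in>pending I s \<tau>. s \<tau> - e \<le> loc I i) \<and> (\<forall>i\<in>unreleased I \<tau>. s \<tau> \<le> prd I i) \<and>
     within_budget (\<tau> + R - s \<tau>) \<and> (\<forall>i\<in>pending I s \<tau>. within_budget (\<tau> + s \<tau> + R - 2 * loc I i))"

text \<open>The equation \<open>s \<tau> = - \<tau>\<close> encodes that the agent is still on its
  initial walk to the left. The slack \<open>e\<close> allows for predictions to the left of
  \<open>L\<close>.\<close>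

definition run_invariant :: "real \<Rightarrow> bool" where
  "run_invariant \<tau> \<longleftrightarrow> L - e \<le> s \<tau> \<and> (s \<tau> = - \<tau> \<or> sweeping \<tau>)"

text \<open>Each end costs one \<open>e\<close>: the leftmost request has a prediction of at most
  \<open>L + e\<close>, and no prediction exceeds \<open>R + e\<close>.\<close>

lemma left_le_right: "- L \<le> R + 2 * e"
proof -
  obtain i where i: "i < num I" "loc I i = L"
    using leftmost_attained[OF valid] by metis
  have "Min (prd I ` {..<num I}) \<le> prd I i" using i by simp
  moreover have "Max (prd I ` {..<num I}) \<le> R + e"
    using valid_nonempty[OF valid] max_error_ge rightmost_ge[of _ I]
    by (subst Max_le_iff) (fastforce simp: abs_le_iff)+
  ultimately show ?thesis using near max_error_ge[OF i(1)] i(2) by linarith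
qed

lemma prd_ge: "i < num I \<Longrightarrow> L - e \<le> prd I i"
  using max_error_ge[of i I] leftmost_le[of i I] by linarith

text \<open>Handles the first turn: an agent still on its initial walk has used time
  \<open>- s \<tau> \<le> e - L\<close>, so a sweep to \<open>R\<close> started now meets the first
  alternative of \<open>within_budget\<close>.\<close>

lemma turning_sweeping:
  assumes "run_invariant \<tau>" "\<forall>i\<in>pending I s \<tau>. s \<tau> \<le> loc I i" "\<forall>i\<in>unreleased I \<tau>. s \<tau> \<le> prd I i"
  shows "sweeping \<tau>"
proof (cases "s \<tau> = - \<tau>")
  case True
  have "\<tau> + R - s \<tau> \<le> R - 2 * L + 2 * e"
    using True assms(1) by (simp add: run_invariant_def)
  then have "within_budget (\<tau> + R - s \<tau>)" by (simp add: within_budget_def)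
  moreover have "within_budget (\<tau> + s \<tau> + R - 2 * loc I i)" if "i \<in> pending I s \<tau>" for i
    using assms(2) that by (intro within_budget_mono[OF calculation]) force
  ultimately show ?thesis
    using assms max_error_ge_0[OF valid] unfolding sweeping_def by (auto intro: order_trans[rotated])
next
  case False
  then show ?thesis using assms(1) by (simp add: run_invariant_def)
qed

text \<open>Up to the next event the agent goes to \<open>w1\<close>, then to the leftmost
  outstanding prediction \<open>w2\<close>. Moving right preserves \<open>\<tau> - s \<tau>\<close>
  and moving left preserves \<open>\<tau> + s \<tau>\<close>, so the budgets need a new argument
  only when the agent turns, waits or meets a new release.\<close>

lemma run_invariant_step:
  assumes \<tau>: "\<tau> \<in> events I" "\<tau> < \<tau>'" and next_event: "\<forall>i<num I. rel I i \<le> \<tau> \<or> \<tau>' \<le> rel I i"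
    and U: "unreleased I \<tau> \<noteq> {}" and inv: "run_invariant \<tau>"
  shows "run_invariant \<tau>'"
proof -
  define x y d where "x = s \<tau>" and "y = s \<tau>'" and "d = \<tau>' - \<tau>"
  define w1 w2 where "w1 = Min (prd I ` unreleased I \<tau> \<union> loc I ` pending I s \<tau>)"
    and "w2 = Min (prd I ` unreleased I \<tau>)"
  note fin = finite_pending[of I s \<tau>] finite_unreleased[of I \<tau>]
  have d: "0 < d" "\<tau>' = \<tau> + d" using \<tau> by (auto simp: d_def)
  have walk: "s (\<tau> + c) = walk x [w1, w2] c" if "0 \<le> c" "c \<le> d" for c
    using step[OF \<tau>(1) U, of "\<tau> + c"] next_event that
    by (force simp: w1_def w2_def x_def d_def)
  have y: "y = walk x [w1, w2] d" using walk[of d] d by (simp add: y_def)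
  have w12: "w1 \<le> w2" unfolding w1_def w2_def using fin U by (intro Min_antimono) auto
  have w1_le: "w1 \<le> loc I i" if "i \<in> pending I s \<tau>" for i
    unfolding w1_def using fin that by (intro Min_le) auto
  have w2_le: "w2 \<le> prd I i" if "i \<in> unreleased I \<tau>" for i
    unfolding w2_def using fin that by (intro Min_le) auto
  obtain k where k: "k \<in> unreleased I \<tau>" "prd I k = w2"
    using Min_in[of "prd I ` unreleased I \<tau>"] fin U by (fastforce simp: w2_def)
  have w1_in: "w1 = w2 \<or> (\<exists>i\<in>pending I s \<tau>. loc I i = w1)"
  proof -
    have "w1 \<in> prd I ` unreleased I \<tau> \<union> loc I ` pending I s \<tau>"
      unfolding w1_def using fin U by (intro Min_in) auto
    then show ?thesis using w2_le w12 by fastforce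
  qed
  have num: "i < num I" if "i \<in> pending I s t \<or> i \<in> unreleased I t" for i t
    using that by (auto simp: pending_def unreleased_def)
  have w1_ge: "L - e \<le> w1"
    using w1_in
  proof
    assume "w1 = w2"
    then show ?thesis using prd_ge[of k] num k by auto
  next
    assume "\<exists>i\<in>pending I s \<tau>. loc I i = w1"
    then show ?thesis using leftmost_le[of _ I] num max_error_ge_0[OF valid] by force
  qed
  have U': "i \<in> unreleased I \<tau>" if "i \<in> unreleased I \<tau>'" for i
    using that \<tau> by (auto simp: unreleased_def)
  have O': "(i \<in> pending I s \<tau> \<and> \<not> served I s i \<tau>') \<or> (i \<in> unreleased I \<tau> \<and> rel I i = \<tau>')"
    if "i \<in> pending I s \<tau>'" for i
    using that \<tau> next_event by (force simp: pending_def unreleased_def intro: served_mono)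
  have new: "w2 - e \<le> loc I i" if "i \<in> unreleased I \<tau>" for i
    using w2_le[OF that] max_error_ge[of i I] num[of i \<tau>] that by (simp add: abs_le_iff)
  have goal: "sweeping \<tau>'"
    if "y \<le> w2" "within_budget (\<tau>' + R - y)"
      and old: "\<And>i. i \<in> pending I s \<tau> \<Longrightarrow> \<not> served I s i \<tau>' \<Longrightarrow>
        y \<le> loc I i \<or> (y - e \<le> loc I i \<and> within_budget (\<tau>' + y + R - 2 * loc I i))"
  proof -
    have "y - e \<le> loc I i \<and> within_budget (\<tau>' + y + R - 2 * loc I i)" if "i \<in> pending I s \<tau>'" for i
      using O'[OF that]
    proof (elim disjE conjE)
      assume i: "i \<in> pending I s \<tau>" "\<not> served I s i \<tau>'"
      show ?thesis
      proof (cases "y \<le> loc I i")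
        case True
        then show ?thesis
          using max_error_ge_0[OF valid] within_budget_mono[OF \<open>within_budget (\<tau>' + R - y)\<close>] by auto
      next
        case False
        then show ?thesis using old[OF i] by simp
      qed
    next
      \<comment> \<open>A request released at \<open>\<tau>'\<close> pays for its own detour: as
        \<open>y - loc I i \<le> e\<close>, fetching it and then sweeping fits the alternative of
        \<open>within_budget\<close> for \<open>i\<close>.\<close>
      assume i: "i \<in> unreleased I \<tau>" "rel I i = \<tau>'"
      then have "y - e \<le> loc I i" using new[OF i(1)] \<open>y \<le> w2\<close> by linarith
      then show ?thesis using i num by (auto intro!: within_budget_release[of i])
    qed
    moreover have "y \<le> prd I i" if "i \<in> unreleased I \<tau>'" for i
      using w2_le[OF U'[OF that]] \<open>y \<le> w2\<close> by linarith
    ultimately show ?thesis using that unfolding sweeping_def y_def by auto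
  qed
  have sweep: "sweeping \<tau>" if "x \<le> w1"
    using that w1_le w2_le w12 inv unfolding x_def by (intro turning_sweeping) force+
  have sw: "(\<forall>i\<in>pending I s \<tau>. x - e \<le> loc I i)" "x \<le> w2" "within_budget (\<tau> + R - x)"
    "\<forall>i\<in>pending I s \<tau>. within_budget (\<tau> + x + R - 2 * loc I i)" if "sweeping \<tau>"
    using that k unfolding sweeping_def x_def by auto
  have x_ge: "L - e \<le> x" using inv by (simp add: run_invariant_def x_def)
  consider (left) "d < \<bar>w1 - x\<bar>" "w1 < x" | (right) "d < \<bar>w1 - x\<bar>" "x \<le> w1"
    | (turned) "\<bar>w1 - x\<bar> \<le> d" by linarith
  then show ?thesis
  proof cases
    case left
    have y': "y = x - d" "w1 \<le> y" using y left by (auto simp: sgn_real_def)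
    have "y = - \<tau>' \<or> sweeping \<tau>'"
    proof (cases "x = - \<tau>")
      case True
      then show ?thesis using y' d by simp
    next
      case False
      then have S: "sweeping \<tau>" using inv by (simp add: run_invariant_def x_def)
      note sw = sw[OF S]
      \<comment> \<open>A sweeping agent has \<open>x \<le> w2\<close>, so a target to its left is a
        pending request, whose fetching budget covers the walk.\<close>
      obtain j where j: "j \<in> pending I s \<tau>" "loc I j = w1"
        using w1_in left sw(2) by auto
      have "sweeping \<tau>'"
      proof (rule goal)
        have "within_budget (\<tau> + x + R - 2 * w1)" using sw(4) j by auto
        then show "within_budget (\<tau>' + R - y)"
          by (rule within_budget_mono) (use y' d in simp)
        show "y \<le> loc I i \<or> (y - e \<le> loc I i \<and> within_budget (\<tau>' + y + R - 2 * loc I i))"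
          if "i \<in> pending I s \<tau>" for i
        proof -
          have "\<tau>' + y = \<tau> + x" using y' d by simp
          moreover have "y \<le> x" using y' d by simp
          ultimately show ?thesis using sw(1,4) that by (metis diff_right_mono order_trans)
        qed
        show "y \<le> w2" using sw(2) y' d by simp
      qed
      then show ?thesis by simp
    qed
    then show ?thesis using y' w1_ge by (simp add: run_invariant_def y_def)
  next
    case right
    have y': "y = x + d" "y \<le> w1" using y right d by (auto simp: sgn_real_def)
    note sw = sw[OF sweep[OF right(2)]]
    have "sweeping \<tau>'"
    proof (rule goal)
      show "y \<le> w2" using y' w12 by simp
      have "\<tau>' + R - y = \<tau> + R - x" using y' d by simp
      then show "within_budget (\<tau>' + R - y)" using sw(3) by metis
    qed (use w1_le y' in force)
    then show ?thesis using y' x_ge d by (simp add: run_invariant_def y_def)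
  next
    case turned
    have y': "y = min (w1 + (d - \<bar>w1 - x\<bar>)) w2" using walk2_up[OF w12 turned] y by simp
    have served: "y \<le> loc I i" if "i \<in> pending I s \<tau>" "\<not> served I s i \<tau>'" for i
    proof (rule ccontr)
      assume less: "\<not> y \<le> loc I i"
      \<comment> \<open>The delay after \<open>\<tau>\<close> at which the agent, coming from
        \<open>w1\<close>, passes request \<open>i\<close>, which is already released.\<close>
      define c where "c = loc I i - w1 + \<bar>w1 - x\<bar>"
      have c: "\<bar>w1 - x\<bar> \<le> c" "c \<le> d" "loc I i \<le> w2"
        using w1_le[OF that(1)] less y' by (auto simp: c_def)
      have "s (\<tau> + c) = loc I i"
        using walk[of c] walk2_up[OF w12 c(1)] c by (simp add: c_def)
      moreover have "rel I i \<le> \<tau> + c" using that c by (auto simp: pending_def)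
      ultimately have "served I s i \<tau>'" using c d by (auto simp: served_def)
      then show False using that by simp
    qed
    have "sweeping \<tau>'"
    proof (rule goal)
      show "y \<le> w2" using y' by simp
      show "within_budget (\<tau>' + R - y)"
      proof (cases "y = w2")
        case True
        \<comment> \<open>The agent is at the prediction of \<open>k\<close>, still unreleased
          before \<open>\<tau>'\<close>; waiting is charged to that release, and the prediction is
          at most \<open>e\<close> to the left of \<open>loc I k\<close>.\<close>
        have "\<tau>' \<le> rel I k" "k < num I" using k next_event by (auto simp: unreleased_def)
        then show ?thesis
          using max_error_ge[of k I] k True by (intro within_budget_release[of k]) auto
      next
        case False
        then have y2: "y = w1 + (d - \<bar>w1 - x\<bar>)" "w1 < w2"
          using y' turned w12 by (auto simp: min_def split: if_splits)
        show ?thesis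
        proof (cases "x \<le> w1")
          case True
          then have "\<tau>' + R - y = \<tau> + R - x" using y2 d by simp
          then show ?thesis using sw(3)[OF sweep] True by metis
        next
          case False
          \<comment> \<open>The agent went left to \<open>w1\<close> and turned. On the initial walk
            \<open>L - e \<le> w1\<close> bounds the cost; otherwise \<open>w1\<close> is a pending
            request with a budget for being fetched.\<close>
          then have eq: "\<tau>' + R - y = \<tau> + x + R - 2 * w1" using y2 d by simp
          show ?thesis
          proof (cases "x = - \<tau>")
            case True
            then show ?thesis using eq w1_ge by (simp add: within_budget_def)
          next
            case False
            then have "sweeping \<tau>" using inv by (simp add: run_invariant_def x_def)
            then have "within_budget (\<tau> + x + R - 2 * w1)" using sw(4) w1_in y2 by auto
            then show ?thesis by (simp only: eq)
          qed
        qed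
      qed
    qed (use served in auto)
    moreover have "L - e \<le> y" using y' w1_ge w12 turned by auto
    ultimately show ?thesis by (simp add: run_invariant_def y_def)
  qed
qed

text \<open>Induction along the events. At the preceding event \<open>\<sigma>\<close> the request
  released at \<open>\<tau>\<close> is still outstanding, as the step lemma requires.\<close>

lemma run_invariant_events: "\<tau> \<in> events I \<Longrightarrow> run_invariant \<tau>"
proof (induction "card {u \<in> events I. u < \<tau>}" arbitrary: \<tau> rule: less_induct)
  case less
  show ?case
  proof (cases "\<tau> = 0")
    case True
    then show ?thesis
      using start leftmost_le_0[OF valid] max_error_ge_0[OF valid] by (simp add: run_invariant_def)
  next
    case False
    define E where "E = {u \<in> events I. u < \<tau>}"
    have E: "finite E" "0 \<in> E"
      using False events_ge_0[OF valid less.prems] finite_events by (auto simp: E_def events_def)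
    define \<sigma> where "\<sigma> = Max E"
    have \<sigma>: "\<sigma> \<in> E" "\<And>u. u \<in> E \<Longrightarrow> u \<le> \<sigma>" using E by (auto simp: \<sigma>_def intro!: Max_in)
    have "{u \<in> events I. u < \<sigma>} \<subset> E" using \<sigma>(1) by (auto simp: E_def)
    then have "run_invariant \<sigma>"
      using less.hyps[of \<sigma>] \<sigma>(1) E psubset_card_mono by (auto simp: E_def)
    moreover have "\<forall>i<num I. rel I i \<le> \<sigma> \<or> \<tau> \<le> rel I i"
      using \<sigma>(2) by (force simp: E_def events_def)
    moreover obtain i where "i < num I" "\<tau> = rel I i"
      using less.prems False by (auto simp: events_def)
    ultimately show ?thesis
      using \<sigma>(1) run_invariant_step[of \<sigma> \<tau>] by (auto simp: E_def unreleased_def)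
  qed
qed

text \<open>\<open>T\<close> ends a final walk that takes the left extreme first. An agent still on
  its initial walk and not yet at \<open>a\<close> finishes at \<open>b - 2 * a\<close>, free of any
  error term. In all other cases it is sweeping, and its state bounds either fetching
  \<open>a\<close> or sweeping on from \<open>s t\<close>.\<close>

lemma finish_bound:
  assumes t: "t \<in> events I" "unreleased I t = {}" "pending I s t \<noteq> {}"
    and a: "a = Min (loc I ` pending I s t)" and b: "b = Max (loc I ` pending I s t)"
    and T: "T = t + \<bar>s t - a\<bar> + (b - a)"
  shows "T \<le> R - 2 * L \<or> T \<le> t + (R - L) + e \<and> within_budget T"
proof -
  have a_in: "a \<in> loc I ` pending I s t" and b_in: "b \<in> loc I ` pending I s t"
    using t finite_pending by (auto simp: a b intro!: Min_in Max_in)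
  then have ab: "L \<le> a" "b \<le> R"
    using leftmost_le rightmost_ge by (auto simp: pending_def)
  have inv: "run_invariant t" by (rule run_invariant_events[OF t(1)])
  obtain j where j: "j \<in> pending I s t" "loc I j = a" using a_in by auto
  have S: "T \<le> t + (R - L) + e \<and> within_budget T" if "sweeping t"
  proof (cases "a \<le> s t")
    case True
    then have "T \<le> t + s t + R - 2 * a" using ab T by simp
    moreover have "s t - e \<le> a" "within_budget (t + s t + R - 2 * a)"
      using that j by (auto simp: sweeping_def)
    ultimately show ?thesis using ab by (auto intro: within_budget_mono)
  next
    case False
    then have "T \<le> t + R - s t" using ab T by simp
    moreover have "L - e \<le> s t" "within_budget (t + R - s t)"
      using that inv by (auto simp: sweeping_def run_invariant_def)
    ultimately show ?thesis by (auto intro: within_budget_mono)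
  qed
  show ?thesis
  proof (cases "s t = - t \<and> a < s t")
    case True
    then show ?thesis using T ab by auto
  next
    case False
    have "sweeping t"
    proof (cases "s t = - t")
      case False
      then show ?thesis using inv by (simp add: run_invariant_def)
    next
      case True
      then have "s t \<le> a" using False by simp
      moreover have "a \<le> loc I i" if "i \<in> pending I s t" for i
        using that finite_pending by (simp add: a)
      ultimately show ?thesis
        using inv t by (intro turning_sweeping) force+
    qed
    then show ?thesis using S by simp
  qed
qed


lemma finish_ratio:
  assumes t: "t \<in> events I" "unreleased I t = {}" "pending I s t \<noteq> {}"
    and opt: "s' \<in> trajectories" "\<forall>i<num I. served I s' i Z"
    and \<eta>: "0 \<le> \<eta>" "\<eta> < 2 / 3" "e \<le> \<eta> * (R - L)"
  shows "(3 - 2 * \<eta>) * (t + \<bar>s t - Min (loc I ` pending I s t)\<bar> +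
    (Max (loc I ` pending I s t) - Min (loc I ` pending I s t))) \<le> 5 * Z" (is "_ * ?T \<le> _")
proof (rule ratio_bound[where t = t and L = L and R = R and e = e])
  note extremes = opt_extremes[OF valid opt]
  show "R - L + min (- L) R \<le> Z" by (rule extremes)
  show "t \<le> Z"
    using t(1) opt_release[OF opt(2)] extremes leftmost_le_0[OF valid] rightmost_ge_0[OF valid]
    by (auto simp: events_def)
  have "T \<le> R - 2 * L + 2 * e \<or>
        (\<exists>r x. T \<le> r + R - x + e \<and> r \<le> Z \<and> L \<le> x \<and> x \<le> R \<and> (r + R - x \<le> Z \<or> 2 * R - x \<le> Z))"
    if "within_budget T" for T
    using that opt_release[OF opt(2)] opt_release_extreme[OF valid opt] leftmost_le rightmost_ge
    unfolding within_budget_def by meson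
  then show "?T \<le> R - 2 * L \<or> ?T \<le> t + (R - L) + e \<and>
      (?T \<le> R - 2 * L + 2 * e \<or>
        (\<exists>r x. ?T \<le> r + R - x + e \<and> r \<le> Z \<and> L \<le> x \<and> x \<le> R \<and> (r + R - x \<le> Z \<or> 2 * R - x \<le> Z)))"
    using finish_bound[OF t refl refl refl] by blast
qed (use \<eta> left_le_right leftmost_le_0[OF valid] rightmost_ge_0[OF valid] in auto)

end

section \<open>Reflection\<close>

definition mirror :: "tsp_instance \<Rightarrow> tsp_instance" where
  "mirror I = I\<lparr>loc := \<lambda>i. - loc I i, prd := \<lambda>i. - prd I i\<rparr>"

lemma mirror_simps [simp]:
  "num (mirror I) = num I" "rel (mirror I) = rel I"
  "loc (mirror I) i = - loc I i" "prd (mirror I) i = - prd I i"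
  by (simp_all add: mirror_def)

lemma mirror_images:
  "loc (mirror I) ` A = uminus ` loc I ` A" "prd (mirror I) ` A = uminus ` prd I ` A"
  by auto

declare minus_Max_eq_Min [simp del] minus_Min_eq_Max [simp del]

lemma served_mirror: "served (mirror I) (\<lambda>t. - s t) i t = served I s i t"
  by (simp add: served_def)

lemma mirror_state:
  "pending (mirror I) (\<lambda>t. - s t) t = pending I s t" "unreleased (mirror I) t = unreleased I t"
  "events (mirror I) = events I" "max_error (mirror I) = max_error I"
  by (simp_all add: pending_def unreleased_def events_def max_error_def served_mirror
      abs_minus_commute)

lemma valid_mirror: "valid_instance (mirror I) = valid_instance I"
  by (simp add: valid_instance_def)

lemma mirror_extremes:
  assumes "valid_instance I"
  shows "leftmost (mirror I) = - rightmost I" "rightmost (mirror I) = - leftmost I"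
  using valid_nonempty[OF assms]
  by (simp_all add: leftmost_def rightmost_def mirror_images
      minus_Max_eq_Min[symmetric] minus_Min_eq_Max[symmetric] del: mirror_simps(3,4))

lemma walk_uminus: "walk (- x) (map uminus ws) d = - walk x ws d"
proof (induction ws arbitrary: x d)
  case (Cons w ws)
  have "sgn (x - w) = - sgn (w - x)" "\<bar>x - w\<bar> = \<bar>w - x\<bar>"
    by (simp_all add: sgn_real_def)
  then show ?case using Cons.IH[of w] by simp
qed simp

lemma mirror_trajectory: "s \<in> trajectories \<Longrightarrow> (\<lambda>t. - s t) \<in> trajectories"
proof (rule trajectoriesI)
  fix t u :: real
  assume "s \<in> trajectories" "0 \<le> t" "t \<le> u"
  then show "\<bar>- s u - - s t\<bar> \<le> u - t" using trajectoriesD[of s t u] by simp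
qed (simp add: trajectories_def)

section \<open>The trajectory of NEARFIRST\<close>

text \<open>Plans depend only on the past, so later replanning does not alter them.\<close>

lemma nearfirst_plan_cong:
  assumes "\<And>u. u \<le> \<tau> \<Longrightarrow> s u = s' u"
  shows "nearfirst_plan I s \<tau> = nearfirst_plan I s' \<tau>"
proof -
  have "served I s i \<tau> = served I s' i \<tau>" for i
    using assms by (auto simp: served_def)
  moreover have "s \<tau> = s' \<tau>" using assms by simp
  ultimately show ?thesis by (simp only: nearfirst_plan_def)
qed

text \<open>The last replanning changes only later times, so induction can remove events from the
  end. \<open>t\<close> may equal the next event time, where the position is still the one reached
  under the old plan.\<close>

lemma fold_replan:
  assumes "sorted \<tau>s" "distinct \<tau>s" "\<tau> \<in> set \<tau>s" "\<tau> \<le> t" "\<forall>u\<in>set \<tau>s. u \<le> \<tau> \<or> t \<le> u"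
  shows "fold (replan I) \<tau>s s0 t =
    walk (fold (replan I) \<tau>s s0 \<tau>) (nearfirst_plan I (fold (replan I) \<tau>s s0) \<tau>) (t - \<tau>)"
  using assms
proof (induction \<tau>s rule: rev_induct)
  case (snoc e \<tau>s)
  define s1 where "s1 = fold (replan I) \<tau>s s0"
  have s: "fold (replan I) (\<tau>s @ [e]) s0 = replan I e s1" by (simp add: s1_def)
  have same: "replan I e s1 u = s1 u" if "u \<le> e" for u using that by (simp add: replan_def)
  have plan: "nearfirst_plan I (replan I e s1) \<tau> = nearfirst_plan I s1 \<tau>" if "\<tau> \<le> e"
    using same that by (intro nearfirst_plan_cong) auto
  show ?case
  proof (cases "\<tau> = e")
    case True
    show ?thesis unfolding s using plan True snoc.prems
      by (cases "t = e") (auto simp: replan_def walk_0)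
  next
    case False
    then have "\<tau> \<in> set \<tau>s" "\<tau> < e" "t \<le> e" using snoc.prems by (auto simp: sorted_append)
    moreover have "s1 t = walk (s1 \<tau>) (nearfirst_plan I s1 \<tau>) (t - \<tau>)"
      unfolding s1_def using snoc calculation by (auto simp: sorted_append)
    ultimately show ?thesis unfolding s using plan same by simp
  qed
qed simp

lemma nearfirst_walk:
  assumes I: "valid_instance I" and "\<tau> \<in> events I" "\<tau> \<le> t" "\<forall>i<num I. rel I i \<le> \<tau> \<or> t \<le> rel I i"
  shows "nearfirst I t = walk (nearfirst I \<tau>) (nearfirst_plan I (nearfirst I) \<tau>) (t - \<tau>)"
proof -
  have set: "set (event_times I) = events I"
    unfolding event_times_def events_def by (subst set_sorted_list_of_set) auto
  show ?thesis
    unfolding nearfirst_def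
  proof (rule fold_replan)
    show "sorted (event_times I)" "distinct (event_times I)" by (simp_all add: event_times_def
      del: sorted_list_of_set_insert_remove)
    show "\<forall>u\<in>set (event_times I). u \<le> \<tau> \<or> t \<le> u"
      using assms events_ge_0[OF I] by (auto simp: set events_def)
  qed (use assms set in auto)
qed

lemma nearfirst_plan_unfold:
  "nearfirst_plan I s \<tau> =
    (let Rq = loc I ` pending I s \<tau>; P = prd I ` {..<num I}; P' = prd I ` unreleased I \<tau>
     in if P' = {} then
          (if Rq = {} then []
           else if s \<tau> < (Max Rq + Min Rq) / 2 then [Min Rq, Max Rq]
           else [Max Rq, Min Rq])
        else if \<bar>Min P\<bar> < \<bar>Max P\<bar> then [Min (P' \<union> Rq), Min P']
        else [Max (P' \<union> Rq), Max P'])"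
  by (simp add: nearfirst_plan_def pending_def unreleased_def)

lemma prediction_signs:
  assumes "valid_instance I"
  shows "Min (prd I ` {..<num I}) \<le> 0" "0 \<le> Max (prd I ` {..<num I})"
proof -
  obtain i where "i < num I" "prd I i = 0" using assms by (auto simp: valid_instance_def)
  then show "Min (prd I ` {..<num I}) \<le> 0" "0 \<le> Max (prd I ` {..<num I})"
    using Min_le[of "prd I ` {..<num I}" "prd I i"] Max_ge[of "prd I ` {..<num I}" "prd I i"]
    by auto
qed

lemma nearfirst_0: "valid_instance I \<Longrightarrow> nearfirst I 0 = 0"
  using nearfirst_trajectory[of I] by (simp add: trajectories_def)

lemma nearfirst_leftward:
  assumes I: "valid_instance I" and less: "\<bar>Min (prd I ` {..<num I})\<bar> < \<bar>Max (prd I ` {..<num I})\<bar>"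
  shows "leftward_run I (nearfirst I)"
proof
  show "- Min (prd I ` {..<num I}) \<le> Max (prd I ` {..<num I})"
    using less prediction_signs[OF I] by linarith
next
  fix \<tau> t
  assume "\<tau> \<in> events I" "unreleased I \<tau> \<noteq> {}" "\<tau> \<le> t" "\<forall>i<num I. rel I i \<le> \<tau> \<or> t \<le> rel I i"
  then show "nearfirst I t = walk (nearfirst I \<tau>)
      [Min (prd I ` unreleased I \<tau> \<union> loc I ` pending I (nearfirst I) \<tau>),
       Min (prd I ` unreleased I \<tau>)] (t - \<tau>)"
    using nearfirst_walk[OF I, of \<tau> t] less by (simp add: nearfirst_plan_unfold Let_def del: walk.simps)
qed (use I nearfirst_0 in auto)

lemma nearfirst_rightward:
  assumes I: "valid_instance I" and ge: "\<not> \<bar>Min (prd I ` {..<num I})\<bar> < \<bar>Max (prd I ` {..<num I})\<bar>"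
  shows "leftward_run (mirror I) (\<lambda>t. - nearfirst I t)"
proof
  show "- Min (prd (mirror I) ` {..<num (mirror I)}) \<le> Max (prd (mirror I) ` {..<num (mirror I)})"
    using ge prediction_signs[OF I] valid_nonempty[OF I]
    by (simp add: mirror_images minus_Max_eq_Min[symmetric] minus_Min_eq_Max[symmetric]
        del: mirror_simps(3,4) Max_le_iff)
next
  fix \<tau> t
  assume *: "\<tau> \<in> events (mirror I)" "unreleased (mirror I) \<tau> \<noteq> {}" "\<tau> \<le> t"
    "\<forall>i<num (mirror I). rel (mirror I) i \<le> \<tau> \<or> t \<le> rel (mirror I) i"
  let ?P' = "prd I ` unreleased I \<tau>" and ?O = "loc I ` pending I (nearfirst I) \<tau>"
  have "nearfirst I t = walk (nearfirst I \<tau>) [Max (?P' \<union> ?O), Max ?P'] (t - \<tau>)"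
    using nearfirst_walk[OF I, of \<tau> t] ge *
    by (simp add: nearfirst_plan_unfold Let_def mirror_state del: walk.simps)
  then have "- nearfirst I t =
      walk (- nearfirst I \<tau>) [- Max (?P' \<union> ?O), - Max ?P'] (t - \<tau>)"
    using walk_uminus[of "nearfirst I \<tau>" "[Max (?P' \<union> ?O), Max ?P']" "t - \<tau>"]
    by (simp del: walk.simps)
  moreover have "- Max ?P' = Min (uminus ` ?P')"
    using * finite_unreleased by (subst minus_Max_eq_Min[symmetric]) (auto simp: mirror_state)
  moreover have "- Max (?P' \<union> ?O) = Min (uminus ` ?P' \<union> uminus ` ?O)"
    using * finite_unreleased finite_pending
    by (subst image_Un[symmetric], subst minus_Max_eq_Min[symmetric]) (auto simp: mirror_state)
  ultimately show "- nearfirst I t = walk (- nearfirst I \<tau>)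
      [Min (prd (mirror I) ` unreleased (mirror I) \<tau> \<union>
          loc (mirror I) ` pending (mirror I) (\<lambda>t. - nearfirst I t) \<tau>),
       Min (prd (mirror I) ` unreleased (mirror I) \<tau>)] (t - \<tau>)"
    by (simp add: mirror_images mirror_state del: walk.simps mirror_simps)
qed (use I nearfirst_0 in \<open>auto simp: valid_mirror\<close>)

text \<open>Every point between the waypoints is passed on the second leg, at the time to reach
  \<open>w1\<close> plus the distance from there.\<close>

lemma walk2_visits:
  assumes "min w1 w2 \<le> c" "c \<le> max w1 w2"
  shows "\<exists>d. 0 \<le> d \<and> d \<le> \<bar>w1 - x\<bar> + \<bar>w2 - w1\<bar> \<and> walk x [w1, w2] d = c"
proof (intro exI conjI)
  let ?d = "\<bar>w1 - x\<bar> + \<bar>c - w1\<bar>"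
  show "0 \<le> ?d" "?d \<le> \<bar>w1 - x\<bar> + \<bar>w2 - w1\<bar>" using assms by linarith+
  have "walk x [w1, w2] ?d = walk w1 [w2] \<bar>c - w1\<bar>" by simp
  also have "\<dots> = c"
    using assms by (cases "w1 \<le> w2") (auto simp: sgn_real_def)
  finally show "walk x [w1, w2] ?d = c" .
qed

text \<open>The \<open>min\<close> mirrors the midpoint test of the final plan, which picks the
  nearer extreme first.\<close>

definition finish_time :: "tsp_instance \<Rightarrow> (real \<Rightarrow> real) \<Rightarrow> real \<Rightarrow> real" where
  "finish_time I s t = (let Rq = loc I ` pending I s t in
     if Rq = {} then t else t + min \<bar>s t - Min Rq\<bar> \<bar>s t - Max Rq\<bar> + (Max Rq - Min Rq))"

lemma finish_time_ge: "t \<le> finish_time I s t"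
proof (cases "pending I s t = {}")
  case False
  then have "Min (loc I ` pending I s t) \<le> Max (loc I ` pending I s t)"
    using finite_pending by (intro Min_le Max_in) auto
  then show ?thesis by (simp add: finish_time_def Let_def)
qed (simp add: finish_time_def)

text \<open>After the last release the plan is never replaced, and its two waypoints enclose all
  pending requests.\<close>

lemma nearfirst_finished:
  assumes I: "valid_instance I" and t: "t \<in> events I" "unreleased I t = {}" and i: "i < num I"
  shows "served I (nearfirst I) i (finish_time I (nearfirst I) t)"
proof (cases "i \<in> pending I (nearfirst I) t")
  case False
  then have "served I (nearfirst I) i t"
    using t i by (force simp: pending_def unreleased_def)
  then show ?thesis using finish_time_ge by (rule served_mono)
next
  case True
  let ?s = "nearfirst I"
  define a b where "a = Min (loc I ` pending I ?s t)" and "b = Max (loc I ` pending I ?s t)"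
  have ab: "a \<le> loc I i" "loc I i \<le> b"
    using True finite_pending by (auto simp: a_def b_def)
  obtain w1 w2 where plan: "nearfirst_plan I ?s t = [w1, w2]"
    and w: "min w1 w2 = a" "max w1 w2 = b" "t + (\<bar>w1 - ?s t\<bar> + \<bar>w2 - w1\<bar>) = finish_time I ?s t"
  proof (cases "?s t < (b + a) / 2")
    case less: True
    show ?thesis
    proof (rule that[of a b])
      show "nearfirst_plan I ?s t = [a, b]"
        using less True t by (auto simp: nearfirst_plan_unfold Let_def a_def b_def)
      have "\<bar>?s t - a\<bar> \<le> \<bar>?s t - b\<bar>" using less ab by (simp add: abs_if field_simps)
      then show "t + (\<bar>a - ?s t\<bar> + \<bar>b - a\<bar>) = finish_time I ?s t"
        using True ab by (auto simp: finish_time_def Let_def a_def[symmetric] b_def[symmetric])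
    qed (use ab in auto)
  next
    case ge: False
    show ?thesis
    proof (rule that[of b a])
      show "nearfirst_plan I ?s t = [b, a]"
        using ge True t by (auto simp: nearfirst_plan_unfold Let_def a_def b_def)
      have "\<bar>?s t - b\<bar> \<le> \<bar>?s t - a\<bar>" using ge ab by (simp add: abs_if field_simps)
      then show "t + (\<bar>b - ?s t\<bar> + \<bar>a - b\<bar>) = finish_time I ?s t"
        using True ab by (auto simp: finish_time_def Let_def a_def[symmetric] b_def[symmetric])
    qed (use ab in auto)
  qed
  obtain d where d: "0 \<le> d" "t + d \<le> finish_time I ?s t" "walk (?s t) [w1, w2] d = loc I i"
    using walk2_visits[of w1 w2 "loc I i" "?s t"] ab w by auto
  have rel: "rel I j \<le> t" if "j < num I" for j
    using t that by (force simp: unreleased_def)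
  have "?s (t + d) = loc I i"
    using nearfirst_walk[OF I t(1), of "t + d"] plan d rel by (simp del: walk.simps)
  then show ?thesis
    using d rel[OF i] unfolding served_def by (intro exI[of _ "t + d"]) auto
qed

section \<open>The competitive ratio\<close>

text \<open>This holds for every trajectory. Inside \<open>[a, b]\<close> the nearer end is at most
  half the width away. Outside, the remaining walk runs straight to the far end, over at most
  \<open>t\<close> plus the distance of that end from the origin. The last release, the width and
  both ends are bounded by \<open>Z\<close>.\<close>

lemma finish_time_le_3:
  assumes I: "valid_instance I" and t: "t \<in> events I" and s: "s \<in> trajectories"
    and opt: "s' \<in> trajectories" "\<forall>i<num I. served I s' i Z"
  shows "finish_time I s t \<le> 3 * Z"
proof -
  note extremes = opt_extremes[OF I opt] leftmost_le_0[OF I] rightmost_ge_0[OF I]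
  have t_le: "0 \<le> t" "t \<le> Z"
    using t opt_release[OF opt(2)] extremes events_ge_0[OF I t] by (auto simp: events_def)
  show ?thesis
  proof (cases "pending I s t = {}")
    case True
    then show ?thesis using t_le by (simp add: finish_time_def)
  next
    case False
    define a b where "a = Min (loc I ` pending I s t)" and "b = Max (loc I ` pending I s t)"
    have "a \<in> loc I ` pending I s t" "b \<in> loc I ` pending I s t"
      unfolding a_def b_def using False finite_pending by (auto intro!: Min_in Max_in)
    then have ab: "leftmost I \<le> a" "b \<le> rightmost I" "a \<le> b"
      using leftmost_le rightmost_ge finite_pending by (auto simp: pending_def a_def b_def)
    have "finish_time I s t = t + min \<bar>s t - a\<bar> \<bar>s t - b\<bar> + (b - a)"
      using False by (simp add: finish_time_def Let_def a_def b_def)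
    then show ?thesis
      using trajectory_bound[OF s t_le(1)] t_le extremes ab
      by (simp add: min_def abs_if split: if_splits)
  qed
qed

lemma finish_time_ratio:
  assumes I: "valid_instance I" and t: "t \<in> events I" "unreleased I t = {}"
    and opt: "s' \<in> trajectories" "\<forall>i<num I. served I s' i Z"
    and \<eta>: "0 \<le> \<eta>" "\<eta> < 2 / 3" "max_error I \<le> \<eta> * (rightmost I - leftmost I)"
  shows "(3 - 2 * \<eta>) * finish_time I (nearfirst I) t \<le> 5 * Z"
proof (cases "pending I (nearfirst I) t = {}")
  case True
  note extremes = opt_extremes[OF I opt] leftmost_le_0[OF I] rightmost_ge_0[OF I]
  have "0 \<le> t" "t \<le> Z"
    using t opt_release[OF opt(2)] extremes events_ge_0[OF I t(1)] by (auto simp: events_def)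
  then have "(3 - 2 * \<eta>) * t \<le> 5 * Z" using \<eta> by (intro mult_mono) auto
  then show ?thesis using True by (simp add: finish_time_def)
next
  case False
  define a b where "a = Min (loc I ` pending I (nearfirst I) t)"
    and "b = Max (loc I ` pending I (nearfirst I) t)"
  have T: "finish_time I (nearfirst I) t =
      t + min \<bar>nearfirst I t - a\<bar> \<bar>nearfirst I t - b\<bar> + (b - a)"
    using False by (simp add: finish_time_def Let_def a_def b_def)
  \<comment> \<open>The actual plan is no slower than starting with either extreme, so
    \<open>c\<close> may be the one on the side favoured by the predictions.\<close>
  have "\<exists>c. (3 - 2 * \<eta>) * (t + \<bar>nearfirst I t - c\<bar> + (b - a)) \<le> 5 * Z \<and> (c = a \<or> c = b)"
  proof (cases "\<bar>Min (prd I ` {..<num I})\<bar> < \<bar>Max (prd I ` {..<num I})\<bar>")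
    case True
    interpret leftward_run I "nearfirst I" using nearfirst_leftward[OF I True] .
    show ?thesis
      using finish_ratio[OF t False opt \<eta>] by (auto simp: a_def b_def)
  next
    case less: False
    interpret leftward_run "mirror I" "\<lambda>t. - nearfirst I t" using nearfirst_rightward[OF I less] .
    have "(3 - 2 * \<eta>) * (t + \<bar>- nearfirst I t - Min (uminus ` loc I ` pending I (nearfirst I) t)\<bar> +
        (Max (uminus ` loc I ` pending I (nearfirst I) t) -
         Min (uminus ` loc I ` pending I (nearfirst I) t))) \<le> 5 * Z"
      using finish_ratio[of t "\<lambda>t. - s' t" Z \<eta>] t False opt \<eta>
      by (simp add: mirror_state mirror_images mirror_extremes[OF I] served_mirror
          mirror_trajectory del: mirror_simps(3,4))
    then have "(3 - 2 * \<eta>) * (t + \<bar>nearfirst I t - b\<bar> + (b - a)) \<le> 5 * Z"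
      using False finite_pending
      by (simp add: minus_Max_eq_Min[symmetric] minus_Min_eq_Max[symmetric] a_def b_def
          abs_minus_commute)
    then show ?thesis by blast
  qed
  then obtain c where c: "(3 - 2 * \<eta>) * (t + \<bar>nearfirst I t - c\<bar> + (b - a)) \<le> 5 * Z" "c = a \<or> c = b"
    by blast
  have "(3 - 2 * \<eta>) * finish_time I (nearfirst I) t \<le>
      (3 - 2 * \<eta>) * (t + \<bar>nearfirst I t - c\<bar> + (b - a))"
    unfolding T using \<eta> c(2) by (intro mult_left_mono) auto
  then show ?thesis using c(1) by linarith
qed

section \<open>From bounds on real times to extended-real makespans\<close>

lemma makespan_le: "0 \<le> T \<Longrightarrow> \<forall>i<num I. served I s i T \<Longrightarrow> makespan I s \<le> ereal T"
  by (auto simp: makespan_def intro: INF_lower)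

text \<open>Dividing by \<open>c\<close> makes this a lower bound on an infimum, so the optimum need
  be neither attained nor finite.\<close>

lemma le_opt_makespan:
  assumes c: "0 < c" and T: "\<And>s Z. s \<in> trajectories \<Longrightarrow> \<forall>i<num I. served I s i Z \<Longrightarrow> T \<le> c * Z"
  shows "ereal T \<le> ereal c * opt_makespan I"
proof -
  have "ereal (T / c) \<le> opt_makespan I"
    unfolding opt_makespan_def makespan_def
    using c T by (intro INF_greatest) (auto simp: field_simps)
  then have "ereal c * ereal (T / c) \<le> ereal c * opt_makespan I"
    using c by (intro ereal_mult_left_mono) auto
  then show ?thesis using c by simp
qed

lemma nearfirst_ratio_less:
  assumes "\<eta> < 2 / 3"
  shows "nearfirst_ratio (ereal \<eta>) = ereal (5 / (3 - 2 * \<eta>))"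
  using assms by (simp add: nearfirst_ratio_def field_simps one_ereal_def numeral_eq_ereal)

lemma pred_error_less:
  assumes I: "valid_instance I" and less: "pred_error I < 2 / 3"
  obtains \<eta> where "pred_error I = ereal \<eta>" "0 \<le> \<eta>" "\<eta> < 2 / 3"
    "max_error I \<le> \<eta> * (rightmost I - leftmost I)"
proof -
  define M where "M = rightmost I - leftmost I"
  have M: "\<bar>leftmost I\<bar> + \<bar>rightmost I\<bar> = M" "0 \<le> M"
    using leftmost_le_0[OF I] rightmost_ge_0[OF I] by (auto simp: M_def)
  have err: "pred_error I = ereal (max_error I) / ereal M"
    by (simp add: pred_error_def M max_error_def)
  have e: "0 \<le> max_error I" by (rule max_error_ge_0[OF I])
  show ?thesis
  proof (cases "M = 0")
    case True
    \<comment> \<open>All requests are at the origin. A positive error over \<open>0\<close> would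
      be infinite, so the predictions are exact and \<open>\<eta> = 0\<close> serves.\<close>
    have "max_error I = 0"
    proof (rule ccontr)
      assume "max_error I \<noteq> 0"
      then have "pred_error I = \<infinity>" using e True by (simp add: err divide_ereal_def)
      then show False using less by simp
    qed
    then show ?thesis using that[of 0] True by (simp add: err M_def[symmetric] zero_ereal_def)
  next
    case False
    then have "pred_error I = ereal (max_error I / M)" by (simp add: err)
    moreover have "max_error I / M < 2 / 3"
      using less calculation by (simp add: numeral_eq_ereal)
    ultimately show ?thesis
      using that[of "max_error I / M"] e M False by (simp add: M_def[symmetric])
  qed
qed

theorem theorem3:
  shows "competitive nearfirst (\<lambda>\<eta>. min (nearfirst_ratio \<eta>) 3)"
  unfolding competitive_def
proof (intro allI impI)
  fix I
  assume I: "valid_instance I"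
  define t where "t = Max (events I)"
  define T where "T = finish_time I (nearfirst I) t"
  have t: "t \<in> events I"
    unfolding t_def using finite_events by (intro Max_in) (auto simp: events_def)
  have "\<forall>i<num I. rel I i \<le> t"
    unfolding t_def using finite_events by (auto intro!: Max_ge simp: events_def)
  then have last: "unreleased I t = {}" by (auto simp: unreleased_def not_less)
  have "0 \<le> T"
    using events_ge_0[OF I t] finish_time_ge[of t I "nearfirst I"] by (simp add: T_def)
  then have alg: "makespan I (nearfirst I) \<le> ereal T"
    using nearfirst_finished[OF I t last] by (intro makespan_le) (auto simp: T_def)
  have three: "ereal T \<le> 3 * opt_makespan I"
    using le_opt_makespan[of 3 I T] finish_time_le_3[OF I t nearfirst_trajectory[OF I]]
    by (simp add: T_def)
  have "ereal T \<le> min (nearfirst_ratio (pred_error I)) 3 * opt_makespan I"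
  proof (cases "pred_error I < 2 / 3")
    case True
    then obtain \<eta> where \<eta>: "pred_error I = ereal \<eta>" "0 \<le> \<eta>" "\<eta> < 2 / 3"
      "max_error I \<le> \<eta> * (rightmost I - leftmost I)"
      using pred_error_less[OF I] by metis
    have "ereal T \<le> ereal (5 / (3 - 2 * \<eta>)) * opt_makespan I"
    proof (rule le_opt_makespan)
      fix s Z
      assume "s \<in> trajectories" "\<forall>i<num I. served I s i Z"
      from finish_time_ratio[OF I t last this \<eta>(2-4)]
      show "T \<le> 5 / (3 - 2 * \<eta>) * Z" using \<eta> by (simp add: T_def field_simps)
    qed (use \<eta> in simp)
    then show ?thesis
      using three nearfirst_ratio_less[OF \<eta>(3)] by (simp add: \<eta>(1) min_def)
  next
    case False
    then show ?thesis using three by (simp add: nearfirst_ratio_def)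
  qed
  with alg show "makespan I (nearfirst I) \<le> min (nearfirst_ratio (pred_error I)) 3 * opt_makespan I"
    by (rule order_trans)
qed

end
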